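(* Let $T,S\in \mathcal{B}_{A^{1/2}}(\mathcal{H})$. Then the following assertions are equivalent: (1) $T\perp_{\omega_A} S$, i.e. $\omega_A(T+\gamma S)\ge \omega_A(T)$ for all $\gamma\in\mathbb{C}$. (2) For each $\beta\in [0,2\pi)$, there exists a sequence $\{x_k\}$ in $\mathcal{H}$ with $\|x_k\|_A=1$ for all $k$ such that $$\lim_{k\to +\infty}|\langle Tx_k\mid x_k\rangle_A|=\omega_A(T)\quad\text{and}\quad \lim_{k\to +\infty}\operatorname{Re}\left( e^{i\beta}\langle x_k\mid Tx_k\rangle_A \langle Sx_k\mid x_k\rangle_A\right)\geq 0$$ (in particular, both limits exist).
   Context: $\mathcal{H}$ is a complex Hilbert space with inner product $\langle\cdot\mid\cdot\rangle$ (linear in the first variable), $\mathcal{B}(\mathcal{H})$ is the algebra of bounded linear operators on $\mathcal{H}$, and $A\in\mathcal{B}(\mathcal{H})$ is a nonzero positive (semi-definite) operator. Put $\langle x\mid y\rangle_A=\langle Ax\mid y\rangle$ and $\|x\|_A=\langle x\mid x\rangle_A^{1/2}$. $\mathcal{B}_{A^{1/2}}(\mathcal{H})$ (the $A$-bounded operators) is the set of $T\in\mathcal{B}(\mathcal{H})$ for which there is $\lambda>0$ with $\|Tx\|_A\le\lambda\|x\|_A$ for all $x\in\mathcal{H}$. The $A$-numerical radius is $\omega_A(T)=\sup\{|\langle Tx\mid x\rangle_A| : x\in\mathcal{H},\ \|x\|_A=1\}$. *)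

theory Defs
  imports "HOL-Analysis.Analysis"
begin

text \<open>Complex inner product spaces. The inner product is linear in the first variable, the
  real scalar multiplication is the restriction of the complex one, and the norm (hence the
  topology) of the underlying normed space is the one induced by the inner product.\<close>

class complex_inner = real_normed_vector +
  fixes scaleC :: "complex \<Rightarrow> 'a \<Rightarrow> 'a" (infixr "*\<^sub>C" 75)
    and cinner :: "'a \<Rightarrow> 'a \<Rightarrow> complex"
  assumes scaleC_add_right: "c *\<^sub>C (x + y) = c *\<^sub>C x + c *\<^sub>C y"
    and scaleC_add_left: "(c + d) *\<^sub>C x = c *\<^sub>C x + d *\<^sub>C x"
    and scaleC_scaleC: "c *\<^sub>C d *\<^sub>C x = (c * d) *\<^sub>C x"
    and scaleC_one: "1 *\<^sub>C x = x"
    and scaleR_scaleC: "scaleR r x = complex_of_real r *\<^sub>C x"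
    and cinner_commute: "cinner x y = cnj (cinner y x)"
    and cinner_add_left: "cinner (x + y) z = cinner x z + cinner y z"
    and cinner_scaleC_left: "cinner (c *\<^sub>C x) y = c * cinner x y"
    and norm_eq_sqrt_cinner: "norm x = sqrt (Re (cinner x x))"

class complex_hilbert_space = complex_inner + complete_space

instantiation complex :: complex_hilbert_space
begin

definition scaleC_complex :: "complex \<Rightarrow> complex \<Rightarrow> complex" where
  "scaleC_complex c x = c * x"

definition cinner_complex :: "complex \<Rightarrow> complex \<Rightarrow> complex" where
  "cinner_complex x y = x * cnj y"

instance
  by standard
    (auto simp: scaleC_complex_def cinner_complex_def algebra_simps scaleR_conv_of_real
      cmod_def power2_eq_square)

end

definition bounded_operators :: "('a::complex_inner \<Rightarrow> 'a) set" where
  "bounded_operators = {T. bounded_linear T \<and> (\<forall>c x. T (c *\<^sub>C x) = c *\<^sub>C T x)}"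

definition positive_operator :: "('a::complex_inner \<Rightarrow> 'a) \<Rightarrow> bool" where
  "positive_operator A \<longleftrightarrow>
     A \<in> bounded_operators \<and> (\<forall>x. Im (cinner (A x) x) = 0 \<and> 0 \<le> Re (cinner (A x) x))"

definition inner_A :: "('a::complex_inner \<Rightarrow> 'a) \<Rightarrow> 'a \<Rightarrow> 'a \<Rightarrow> complex" where
  "inner_A A x y = cinner (A x) y"

text \<open>For positive \<open>A\<close> the number \<open>inner_A A x x\<close> is real, so taking the real part is only
  a change of type.\<close>

definition norm_A :: "('a::complex_inner \<Rightarrow> 'a) \<Rightarrow> 'a \<Rightarrow> real" where
  "norm_A A x = sqrt (Re (inner_A A x x))"

definition A_bounded_operators :: "('a::complex_inner \<Rightarrow> 'a) \<Rightarrow> ('a \<Rightarrow> 'a) set" where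
  "A_bounded_operators A =
     {T \<in> bounded_operators. \<exists>lam>0. \<forall>x. norm_A A (T x) \<le> lam * norm_A A x}"

text \<open>The supremum is over a nonempty set when \<open>A\<close> is positive and nonzero, and over a set
  bounded above when \<open>T\<close> is moreover \<open>A\<close>-bounded, so \<open>Sup\<close> on the reals is meaningful then.\<close>

definition numerical_radius_A :: "('a::complex_inner \<Rightarrow> 'a) \<Rightarrow> ('a \<Rightarrow> 'a) \<Rightarrow> real" where
  "numerical_radius_A A T = Sup {cmod (inner_A A (T x) x) | x. norm_A A x = 1}"

definition numerical_radius_orthogonal ::
  "('a::complex_inner \<Rightarrow> 'a) \<Rightarrow> ('a \<Rightarrow> 'a) \<Rightarrow> ('a \<Rightarrow> 'a) \<Rightarrow> bool" where
  "numerical_radius_orthogonal A T S \<longleftrightarrow>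
     (\<forall>\<gamma>. numerical_radius_A A (\<lambda>x. T x + \<gamma> *\<^sub>C S x) \<ge> numerical_radius_A A T)"

end

theory Submission
  imports Defs
begin

text \<open>On the \<open>A\<close>-unit vectors put \<open>t x = \<langle>Tx | x\<rangle>\<^sub>A\<close> and \<open>s x = \<langle>Sx | x\<rangle>\<^sub>A\<close>; both are bounded functions, and
  the theorem is a fact about suprema of bounded functions. If \<open>\<gamma> = |\<gamma>| e\<^sup>i\<^sup>\<beta>\<close>, then
  \<open>|t + \<gamma> s|\<^sup>2 = |t|\<^sup>2 + 2 |\<gamma>| Re (e\<^sup>i\<^sup>\<beta> cnj t s) + |\<gamma>|\<^sup>2 |s|\<^sup>2\<close>. Along a sequence as in (2) the right-hand side is
  asymptotically at least \<open>\<omega>(T)\<^sup>2\<close>. Conversely, choosing \<open>x\<^sub>n\<close> with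
  \<open>|t + n\<^sup>-\<^sup>1 e\<^sup>i\<^sup>\<beta> s| > \<omega>(T) - n\<^sup>-\<^sup>2\<close> forces \<open>|t| \<longlonglongrightarrow> \<omega>(T)\<close> and \<open>Re (e\<^sup>i\<^sup>\<beta> cnj t s) \<ge> - O(n\<^sup>-\<^sup>1)\<close>, and a subsequence
  makes the bounded real parts converge.\<close>

section \<open>Suprema of bounded complex-valued functions\<close>

lemma cmod_add_scaled_square:
  "(cmod (a + of_real r * u * b))\<^sup>2 = (cmod a)\<^sup>2 + 2 * r * Re (u * cnj a * b) + r\<^sup>2 * (cmod (u * b))\<^sup>2"
  unfolding cmod_power2 by (simp add: algebra_simps power2_eq_square)

text \<open>The bounds \<open>F\<close> and \<open>G\<close> make the set of values bounded above,
  which the supremum on the reals requires. The case \<gamma> = 0 covers \<open>f\<close>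
  alone.\<close>

lemma cmod_le_perturbed_Sup:
  fixes f g :: "'b \<Rightarrow> complex"
  assumes "x \<in> X"
    and f: "\<And>x. x \<in> X \<Longrightarrow> cmod (f x) \<le> F" and g: "\<And>x. x \<in> X \<Longrightarrow> cmod (g x) \<le> G"
  shows "cmod (f x + \<gamma> * g x) \<le> (SUP x\<in>X. cmod (f x + \<gamma> * g x))"
proof (rule cSUP_upper[OF \<open>x \<in> X\<close>], rule bdd_aboveI2)
  fix x assume "x \<in> X"
  then show "cmod (f x + \<gamma> * g x) \<le> F + cmod \<gamma> * G"
    using norm_triangle_ineq[of "f x" "\<gamma> * g x"] f[of x] mult_left_mono[OF g, of x "cmod \<gamma>"]
    by (simp add: norm_mult)
qed

lemma Sup_cmod_le_perturbed_Sup: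
  fixes f g :: "'b \<Rightarrow> complex" and x :: "nat \<Rightarrow> 'b"
  assumes f: "\<And>x. x \<in> X \<Longrightarrow> cmod (f x) \<le> F" and g: "\<And>x. x \<in> X \<Longrightarrow> cmod (g x) \<le> G"
    and x: "\<And>k. x k \<in> X"
    and lim_f: "(\<lambda>k. cmod (f (x k))) \<longlonglongrightarrow> (SUP x\<in>X. cmod (f x))"
    and lim_re: "(\<lambda>k. Re (u * cnj (f (x k)) * g (x k))) \<longlonglongrightarrow> L"
    and "0 \<le> L" "0 \<le> r"
  shows "(SUP x\<in>X. cmod (f x)) \<le> (SUP x\<in>X. cmod (f x + of_real r * u * g x))"
    (is "?w \<le> ?W")
proof -
  have le: "cmod (f (x k) + of_real r * u * g (x k)) \<le> ?W" for k
    by (rule cmod_le_perturbed_Sup[OF x f g])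
  have "(cmod (f (x k)))\<^sup>2 + 2 * r * Re (u * cnj (f (x k)) * g (x k)) \<le> ?W\<^sup>2" for k
  proof -
    have "(cmod (f (x k) + of_real r * u * g (x k)))\<^sup>2 \<le> ?W\<^sup>2"
      using le by (intro power_mono) auto
    then show ?thesis
      unfolding cmod_add_scaled_square by (smt (verit) mult_nonneg_nonneg zero_le_power2)
  qed
  moreover have "(\<lambda>k. (cmod (f (x k)))\<^sup>2 + 2 * r * Re (u * cnj (f (x k)) * g (x k)))
      \<longlonglongrightarrow> ?w\<^sup>2 + 2 * r * L"
    by (intro tendsto_intros lim_f lim_re)
  ultimately have "?w\<^sup>2 + 2 * r * L \<le> ?W\<^sup>2"
    by (intro LIMSEQ_le_const2) auto
  moreover have "0 \<le> 2 * r * L" using \<open>0 \<le> L\<close> \<open>0 \<le> r\<close> by simp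
  ultimately have "?w\<^sup>2 \<le> ?W\<^sup>2" by linarith
  \<comment> \<open>Taking roots requires \<open>?W\<close> to be nonnegative, which holds because
    it bounds a modulus.\<close>
  then show ?thesis
    by (rule power2_le_imp_le) (rule order_trans[OF norm_ge_zero le])
qed

text \<open>From (1) to (2): the perturbation shrinks in the fixed direction \<open>u\<close>, so
  the linear term has to compensate for errors of second order only.\<close>

lemma maximizing_sequence_of_le_perturbed_Sup:
  fixes f g :: "'b \<Rightarrow> complex"
  assumes "X \<noteq> {}"
    and f: "\<And>x. x \<in> X \<Longrightarrow> cmod (f x) \<le> F" and g: "\<And>x. x \<in> X \<Longrightarrow> cmod (g x) \<le> G"
    and u: "cmod u = 1"
    and le: "\<And>r. 0 < r \<Longrightarrow>
      (SUP x\<in>X. cmod (f x)) \<le> (SUP x\<in>X. cmod (f x + of_real r * u * g x))"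
  obtains x :: "nat \<Rightarrow> 'b" and L where "\<And>k. x k \<in> X"
    and "(\<lambda>k. cmod (f (x k))) \<longlonglongrightarrow> (SUP x\<in>X. cmod (f x))"
    and "0 \<le> L" and "(\<lambda>k. Re (u * cnj (f (x k)) * g (x k))) \<longlonglongrightarrow> L"
proof -
  define w where "w = (SUP x\<in>X. cmod (f x))"
  define r where "r n = 1 / real (Suc n)" for n
  have r_pos: "0 < r n" for n by (simp add: r_def)
  have r_lim: "r \<longlonglongrightarrow> 0" unfolding r_def using LIMSEQ_Suc[OF lim_1_over_n] by simp
  have f_le: "cmod (f x) \<le> w" if "x \<in> X" for x
    using cmod_le_perturbed_Sup[OF that f g, where \<gamma> = 0] by (simp add: w_def)
  have w_nonneg: "0 \<le> w" using \<open>X \<noteq> {}\<close> f_le norm_ge_zero order_trans by blast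
  \<comment> \<open>The slack is quadratic in \<open>r n\<close> so that it still tends to 0 after
    the later division by \<open>r n\<close>; a linear slack would bound \<open>h\<close> below only
    by a constant.\<close>
  have "\<exists>x\<in>X. w - (r n)\<^sup>2 < cmod (f x + of_real (r n) * u * g x)" for n
  proof -
    have "w - (r n)\<^sup>2 < (SUP x\<in>X. cmod (f x + of_real (r n) * u * g x))"
      using le[OF r_pos, of n] r_pos[of n] zero_less_power[OF r_pos, of n 2]
      unfolding w_def by linarith
    then show ?thesis
      by (rule less_cSupE) (use \<open>X \<noteq> {}\<close> in auto)
  qed
  then obtain y where y: "\<And>n. y n \<in> X"
    and y_gt: "\<And>n. w - (r n)\<^sup>2 < cmod (f (y n) + of_real (r n) * u * g (y n))"
    by metis
  define h where "h n = Re (u * cnj (f (y n)) * g (y n))" for n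
  have f_ge: "w - (r n)\<^sup>2 - r n * G \<le> cmod (f (y n))" for n
  proof -
    have "cmod (of_real (r n) * u * g (y n)) \<le> r n * G"
      using r_pos[of n] u g[OF y] by (simp add: norm_mult mult_left_mono)
    then show ?thesis
      using y_gt[of n] norm_triangle_ineq[of "f (y n)" "of_real (r n) * u * g (y n)"] by linarith
  qed
  have f_lim: "(\<lambda>n. cmod (f (y n))) \<longlonglongrightarrow> w"
  proof (rule tendsto_sandwich)
    show "(\<lambda>n. w - (r n)\<^sup>2 - r n * G) \<longlonglongrightarrow> w"
      by (rule tendsto_eq_intros r_lim refl | simp)+
    show "(\<lambda>_. w) \<longlonglongrightarrow> w" by simp
  qed (use f_ge f_le[OF y] in auto)
  have h_ge: "- (r n * (2 * w + G\<^sup>2) / 2) \<le> h n" for n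
  proof -
    let ?z = "cmod (f (y n) + of_real (r n) * u * g (y n))"
    \<comment> \<open>This form of \<open>w - r\<^sup>2 < ?z\<close> needs no case distinction on the sign of \<open>w - r\<^sup>2\<close>.\<close>
    have "w\<^sup>2 - 2 * w * (r n)\<^sup>2 \<le> ?z\<^sup>2"
    proof -
      have "0 \<le> (?z - w)\<^sup>2" by simp
      moreover have "w * (w - (r n)\<^sup>2) \<le> w * ?z"
        using y_gt[of n] w_nonneg by (intro mult_left_mono) auto
      ultimately show ?thesis by (simp add: power2_eq_square algebra_simps)
    qed
    moreover have "?z\<^sup>2 = (cmod (f (y n)))\<^sup>2 + 2 * r n * h n + (r n)\<^sup>2 * (cmod (g (y n)))\<^sup>2"
      unfolding cmod_add_scaled_square h_def by (simp add: norm_mult u)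
    moreover have "(cmod (f (y n)))\<^sup>2 \<le> w\<^sup>2"
      using f_le[OF y] by (intro power_mono) auto
    moreover have "(r n)\<^sup>2 * (cmod (g (y n)))\<^sup>2 \<le> (r n)\<^sup>2 * G\<^sup>2"
      using g[OF y] by (intro mult_left_mono power_mono) auto
    ultimately have "- (2 * w * (r n)\<^sup>2) - (r n)\<^sup>2 * G\<^sup>2 \<le> 2 * r n * h n" by linarith
    then have "r n * (- (r n * (2 * w + G\<^sup>2) / 2)) \<le> r n * h n"
      by (simp add: power2_eq_square field_simps)
    then show ?thesis by (rule mult_left_le_imp_le) (rule r_pos)
  qed
  have "\<bar>h n\<bar> \<le> F * G" for n
  proof -
    have "\<bar>h n\<bar> \<le> cmod (f (y n)) * cmod (g (y n))"
      unfolding h_def by (rule order_trans[OF abs_Re_le_cmod]) (simp add: norm_mult u)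
    also have "\<dots> \<le> F * G"
      using f[OF y] g[OF y] by (intro mult_mono) (auto intro: order_trans[OF norm_ge_zero])
    finally show ?thesis .
  qed
  then have "bounded (range h)" by (auto simp: bounded_iff)
  then obtain L \<phi> where \<phi>: "strict_mono \<phi>" and L: "(h \<circ> \<phi>) \<longlonglongrightarrow> L"
    using bounded_imp_convergent_subsequence by blast
  have "(\<lambda>n. - (r (\<phi> n) * (2 * w + G\<^sup>2) / 2)) \<longlonglongrightarrow> 0"
    using LIMSEQ_subseq_LIMSEQ[OF r_lim \<phi>] unfolding o_def
    by (auto intro!: tendsto_eq_intros)
  from this L have "0 \<le> L"
    by (rule LIMSEQ_le) (use h_ge in auto)
  show thesis
  proof (rule that)
    show "(\<lambda>k. cmod (f ((y \<circ> \<phi>) k))) \<longlonglongrightarrow> (SUP x\<in>X. cmod (f x))"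
      using LIMSEQ_subseq_LIMSEQ[OF f_lim \<phi>] by (simp add: o_def w_def)
    show "(\<lambda>k. Re (u * cnj (f ((y \<circ> \<phi>) k)) * g ((y \<circ> \<phi>) k))) \<longlonglongrightarrow> L"
      using L by (simp add: o_def h_def)
  qed (use y \<open>0 \<le> L\<close> in auto)
qed

section \<open>The semi-inner product of a positive operator\<close>

lemma cinner_add_right: "cinner x (y + z) = cinner x y + cinner x z"
  by (subst (1 2 3) cinner_commute) (simp add: cinner_add_left)

lemma cinner_scaleC_right: "cinner x (c *\<^sub>C y) = cnj c * cinner x y"
  by (subst (1 2) cinner_commute) (simp add: cinner_scaleC_left)

lemma
  assumes "positive_operator A"
  shows inner_A_add_left: "inner_A A (x + y) z = inner_A A x z + inner_A A y z"
    and inner_A_add_right: "inner_A A x (y + z) = inner_A A x y + inner_A A x z"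
    and inner_A_scaleC_left: "inner_A A (c *\<^sub>C x) z = c * inner_A A x z"
    and inner_A_scaleC_right: "inner_A A x (c *\<^sub>C z) = cnj c * inner_A A x z"
    and Im_inner_A_self: "Im (inner_A A x x) = 0"
    and Re_inner_A_self: "Re (inner_A A x x) = (norm_A A x)\<^sup>2"
  using assms
  by (simp_all add: inner_A_def norm_A_def positive_operator_def bounded_operators_def
      bounded_linear.linear linear_add cinner_add_left cinner_add_right cinner_scaleC_left
      cinner_scaleC_right)

\<comment> \<open>Over the complex numbers a form that is real on the diagonal is Hermitian: expand at
  \<open>x + y\<close> and at \<open>x + \<i> y\<close>.\<close>
lemma inner_A_commute:
  assumes "positive_operator A"
  shows "inner_A A y x = cnj (inner_A A x y)"
proof -
  note simps = inner_A_add_left[OF assms] inner_A_add_right[OF assms]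
    inner_A_scaleC_left[OF assms] inner_A_scaleC_right[OF assms] Im_inner_A_self[OF assms]
  show ?thesis
    using Im_inner_A_self[OF assms, of "x + y"] Im_inner_A_self[OF assms, of "x + \<i> *\<^sub>C y"]
    by (auto simp: complex_eq_iff simps)
qed

lemma norm_A_scaleC:
  assumes "positive_operator A"
  shows "norm_A A (c *\<^sub>C x) = cmod c * norm_A A x"
proof -
  have "inner_A A (c *\<^sub>C x) (c *\<^sub>C x) = of_real ((cmod c)\<^sup>2) * inner_A A x x"
    using complex_norm_square[of c]
    by (simp add: inner_A_scaleC_left[OF assms] inner_A_scaleC_right[OF assms] mult_ac)
  then show ?thesis
    by (simp add: norm_A_def real_sqrt_mult)
qed

text \<open>An additive form of Cauchy-Schwarz: positivity at \<open>x + c y\<close> with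
  \<open>c\<close> unimodular suffices, so there is no division by a seminorm that may vanish. It
  serves both to detect a vanishing form and to bound the form on A-unit vectors.\<close>

lemma cmod_inner_A_le:
  assumes "positive_operator A"
  shows "2 * cmod (inner_A A x y) \<le> (norm_A A x)\<^sup>2 + (norm_A A y)\<^sup>2"
proof -
  \<comment> \<open>This phase makes the cross term real and as negative as possible.\<close>
  define c where "c = - cis (Arg (inner_A A x y))"
  have "cnj c * inner_A A x y = - of_real (cmod (inner_A A x y))"
    by (subst (2) rcis_cmod_Arg[symmetric]) (simp add: c_def rcis_def cis_cnj cis_mult)
  then have xy: "Re (inner_A A x (c *\<^sub>C y)) = - cmod (inner_A A x y)"
    by (simp add: inner_A_scaleC_right[OF assms])
  have "0 \<le> Re (inner_A A (x + c *\<^sub>C y) (x + c *\<^sub>C y))"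
    by (simp add: Re_inner_A_self[OF assms])
  also have "\<dots> = (norm_A A x)\<^sup>2 + (norm_A A (c *\<^sub>C y))\<^sup>2 + 2 * Re (inner_A A x (c *\<^sub>C y))"
    by (simp add: inner_A_add_left[OF assms] inner_A_add_right[OF assms]
        inner_A_commute[OF assms, of "c *\<^sub>C y" x] flip: Re_inner_A_self[OF assms])
  finally show ?thesis
    by (simp add: xy norm_A_scaleC[OF assms]) (simp add: c_def)
qed

text \<open>A vector of nonzero seminorm can be rescaled. If there were none, the whole form would
  vanish by \<open>cmod_inner_A_le\<close>, and hence \<open>A\<close> too.\<close>

lemma exists_A_unit_vector:
  assumes "positive_operator A" "A \<noteq> (\<lambda>x. 0)"
  obtains x where "norm_A A x = 1"
proof -
  obtain x where "norm_A A x \<noteq> 0"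
  proof (rule ccontr)
    assume "\<not> thesis"
    with that have "norm_A A x = 0" for x by blast
    then have "inner_A A x y = 0" for x y
      using cmod_inner_A_le[OF assms(1), of x y] by simp
    \<comment> \<open>Take \<open>y = A x\<close>: then \<open>inner_A A x y\<close> is the square
      of the norm of \<open>A x\<close>.\<close>
    then have "norm (A x) = 0" for x
      by (simp add: norm_eq_sqrt_cinner inner_A_def)
    with assms(2) show False by auto
  qed
  moreover have "0 \<le> norm_A A x"
    using assms(1) by (simp add: norm_A_def inner_A_def positive_operator_def)
  ultimately show thesis
    by (intro that[of "of_real (1 / norm_A A x) *\<^sub>C x"])
      (simp add: norm_A_scaleC[OF assms(1)] norm_divide)
qed

lemma A_bounded_inner_A_bounded:
  assumes "positive_operator A" "T \<in> A_bounded_operators A"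
  obtains B where "\<And>x. norm_A A x = 1 \<Longrightarrow> cmod (inner_A A (T x) x) \<le> B"
proof -
  obtain lam where lam: "\<And>x. norm_A A (T x) \<le> lam * norm_A A x"
    using assms(2) by (auto simp: A_bounded_operators_def)
  have "cmod (inner_A A (T x) x) \<le> (lam\<^sup>2 + 1) / 2" if "norm_A A x = 1" for x
  proof -
    have "0 \<le> norm_A A (T x)"
      using assms(1) by (simp add: norm_A_def inner_A_def positive_operator_def)
    then have "(norm_A A (T x))\<^sup>2 \<le> lam\<^sup>2"
      using lam[of x] that by (intro power_mono) auto
    then show ?thesis
      using cmod_inner_A_le[OF assms(1), of "T x" x] that by simp
  qed
  then show thesis by (rule that)
qed

section \<open>Orthogonality as an inequality between suprema over A-unit vectors\<close>

theorem theorem2p5: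
  fixes A T S :: "'a::complex_hilbert_space \<Rightarrow> 'a"
  assumes "positive_operator A"
    and "A \<noteq> (\<lambda>x. 0)"
    and "T \<in> A_bounded_operators A"
    and "S \<in> A_bounded_operators A"
  shows "numerical_radius_orthogonal A T S \<longleftrightarrow>
    (\<forall>\<beta>\<in>{0..<2 * pi}. \<exists>x :: nat \<Rightarrow> 'a.
       (\<forall>k. norm_A A (x k) = 1) \<and>
       (\<lambda>k. cmod (inner_A A (T (x k)) (x k))) \<longlonglongrightarrow> numerical_radius_A A T \<and>
       (\<exists>L\<ge>0. (\<lambda>k. Re (exp (\<i> * complex_of_real \<beta>) *
                        inner_A A (x k) (T (x k)) * inner_A A (S (x k)) (x k))) \<longlonglongrightarrow> L))"
  (is "_ \<longleftrightarrow> (\<forall>\<beta>\<in>_. ?P \<beta>)")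
proof -
  define X where "X = {x. norm_A A x = 1}"
  define f where "f x = inner_A A (T x) x" for x
  define g where "g x = inner_A A (S x) x" for x
  obtain F where F: "\<And>x. x \<in> X \<Longrightarrow> cmod (f x) \<le> F"
    using A_bounded_inner_A_bounded[OF assms(1,3)] by (metis X_def f_def mem_Collect_eq)
  obtain G where G: "\<And>x. x \<in> X \<Longrightarrow> cmod (g x) \<le> G"
    using A_bounded_inner_A_bounded[OF assms(1,4)] by (metis X_def g_def mem_Collect_eq)
  have "X \<noteq> {}"
    using exists_A_unit_vector[OF assms(1,2)] by (auto simp: X_def)
  have radius: "numerical_radius_A A (\<lambda>x. T x + \<gamma> *\<^sub>C S x) = (SUP x\<in>X. cmod (f x + \<gamma> * g x))" for \<gamma>
    by (simp add: numerical_radius_A_def X_def f_def g_def inner_A_add_left[OF assms(1)]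
        inner_A_scaleC_left[OF assms(1)] setcompr_eq_image)
  have radius_T: "numerical_radius_A A T = (SUP x\<in>X. cmod (f x))"
    by (simp add: numerical_radius_A_def X_def f_def setcompr_eq_image)
  have orth: "numerical_radius_orthogonal A T S \<longleftrightarrow>
      (\<forall>\<gamma>. (SUP x\<in>X. cmod (f x)) \<le> (SUP x\<in>X. cmod (f x + \<gamma> * g x)))"
    by (simp add: numerical_radius_orthogonal_def radius radius_T)
  \<comment> \<open>Hermitian symmetry turns the factor with \<open>T\<close> in the second argument
    into \<open>cnj (f (x k))\<close>.\<close>
  have P: "?P \<beta> \<longleftrightarrow> (\<exists>x. (\<forall>k. x k \<in> X) \<and> (\<lambda>k. cmod (f (x k))) \<longlonglongrightarrow> (SUP x\<in>X. cmod (f x)) \<and>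
      (\<exists>L\<ge>0. (\<lambda>k. Re (cis \<beta> * cnj (f (x k)) * g (x k))) \<longlonglongrightarrow> L))" for \<beta>
    by (simp only: X_def f_def g_def radius_T mem_Collect_eq cis_conv_exp
        inner_A_commute[OF assms(1), symmetric])
  show ?thesis
    unfolding orth P
  proof (intro iffI ballI allI)
    fix \<beta> :: real
    assume "\<forall>\<gamma>. (SUP x\<in>X. cmod (f x)) \<le> (SUP x\<in>X. cmod (f x + \<gamma> * g x))"
    then have "(SUP x\<in>X. cmod (f x)) \<le> (SUP x\<in>X. cmod (f x + of_real r * cis \<beta> * g x))" for r
      by blast
    from maximizing_sequence_of_le_perturbed_Sup[OF \<open>X \<noteq> {}\<close> F G norm_cis this]
    obtain x L where "\<And>k. x k \<in> X"
      "(\<lambda>k. cmod (f (x k))) \<longlonglongrightarrow> (SUP x\<in>X. cmod (f x))" "0 \<le> L"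
      "(\<lambda>k. Re (cis \<beta> * cnj (f (x k)) * g (x k))) \<longlonglongrightarrow> L"
      by blast
    then show "\<exists>x. (\<forall>k. x k \<in> X) \<and> (\<lambda>k. cmod (f (x k))) \<longlonglongrightarrow> (SUP x\<in>X. cmod (f x)) \<and>
      (\<exists>L\<ge>0. (\<lambda>k. Re (cis \<beta> * cnj (f (x k)) * g (x k))) \<longlonglongrightarrow> L)"
      by blast
  next
    fix \<gamma> :: complex
    assume "\<forall>\<beta>\<in>{0..<2 * pi}. \<exists>x. (\<forall>k. x k \<in> X) \<and>
      (\<lambda>k. cmod (f (x k))) \<longlonglongrightarrow> (SUP x\<in>X. cmod (f x)) \<and>
      (\<exists>L\<ge>0. (\<lambda>k. Re (cis \<beta> * cnj (f (x k)) * g (x k))) \<longlonglongrightarrow> L)"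
    \<comment> \<open>\<open>Arg2pi\<close> takes its values in exactly the interval of the
      statement. At \<gamma> = 0 it is 0, and the polar form still holds because the modulus
      vanishes.\<close>
    moreover have "Arg2pi \<gamma> \<in> {0..<2 * pi}" by (simp add: Arg2pi_ge_0 Arg2pi_lt_2pi)
    ultimately obtain x L where "\<And>k. x k \<in> X"
      "(\<lambda>k. cmod (f (x k))) \<longlonglongrightarrow> (SUP x\<in>X. cmod (f x))" "0 \<le> L"
      "(\<lambda>k. Re (cis (Arg2pi \<gamma>) * cnj (f (x k)) * g (x k))) \<longlonglongrightarrow> L"
      by blast
    then have "(SUP x\<in>X. cmod (f x)) \<le>
        (SUP x\<in>X. cmod (f x + of_real (cmod \<gamma>) * cis (Arg2pi \<gamma>) * g x))"
      by (intro Sup_cmod_le_perturbed_Sup[OF F G]) auto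
    moreover have "of_real (cmod \<gamma>) * cis (Arg2pi \<gamma>) = \<gamma>"
      using Arg2pi_eq[of \<gamma>] by (simp add: cis_conv_exp)
    ultimately show "(SUP x\<in>X. cmod (f x)) \<le> (SUP x\<in>X. cmod (f x + \<gamma> * g x))" by simp
  qed
qed

end
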